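(* If $G$ is a generalized geodetic graph with $\mathrm{sgc}(G) >\frac{\mathrm{sg}(G)}{2}$ and $H$ is a graph that admits a convex $2$-partition, then $\mathrm{sg}(G \,\square\, H) > \mathrm{sg}(G)$.
   Context: Graphs are finite and simple; strong geodetic notions are considered for connected graphs. $G\,\square\,H$ is the Cartesian product: vertex set $V(G)\times V(H)$, with $(g,h)\sim(g',h')$ iff either $g=g'$ and $hh'\in E(H)$, or $h=h'$ and $gg'\in E(G)$. For $S\subseteq V(G)$, one fixes for each unordered pair $\{x,y\}$ of distinct vertices of $S$ a single shortest $x,y$-path $\widetilde g(x,y)$; $S$ is a strong geodetic set if for some such choice the union of the vertex sets of the chosen paths equals $V(G)$. $\mathrm{sg}(G)$ is the minimum size of a strong geodetic set; a minimum one is an sg-set. For a strong geodetic set $S$, a set $X\subseteq S$ is a strong geodetic core for $S$ if there exists a choice of fixed shortest paths $\widetilde g(x,y)$ for pairs of $S$ such that $\bigcup_{(u,v)\in X\times S} V(\widetilde g(u,v)) = V(G)$; $\mathrm{sgc}(S)$ is the minimum size of a strong geodetic core for $S$, and $\mathrm{sgc}(G)=\min\{\mathrm{sgc}(S): S \text{ an sg-set}\}$. The interval $I_G(u,v)$ is the set of vertices on some shortest $u,v$-path; the geodetic number $\mathrm{g}(G)$ is the minimum size of $S$ with $\bigcup_{\{u,v\}\subseteq S} I_G(u,v)=V(G)$; $G$ is generalized geodetic if $\mathrm{g}(G)=\mathrm{sg}(G)$. A subgraph $K$ of $H$ is convex if for all $u,v\in V(K)$ every shortest $u,v$-path in $H$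 lies in $K$. $H$ admits a convex $2$-partition if $V(H)$ can be partitioned into two nonempty sets each inducing a convex subgraph. *)

theory Defs
  imports "Graph_Theory.Graph_Theory"
begin

text \<open>
  Finite simple graphs are the \<^locale>\<open>pair_graph\<close>s: each edge is a pair of opposite arcs.
  Paths are lists of vertices. \<^const>\<open>connected\<close> excludes the null graph.
\<close>

definition cartesian_product ::
    "'a pair_pre_digraph \<Rightarrow> 'b pair_pre_digraph \<Rightarrow> ('a \<times> 'b) pair_pre_digraph"
    (infixl \<open>\<box>\<close> 70) where
  "G \<box> H = \<lparr> pverts = pverts G \<times> pverts H,
     parcs = {((g, h), (g', h')) | g h g' h'.
       (g = g' \<and> g \<in> pverts G \<and> (h, h') \<in> parcs H) \<or>
       (h = h' \<and> h \<in> pverts H \<and> (g, g') \<in> parcs G)} \<rparr>"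

definition shortest_path :: "('a, 'b) pre_digraph \<Rightarrow> 'a \<Rightarrow> 'a \<Rightarrow> 'a list \<Rightarrow> bool" where
  "shortest_path G x y p \<longleftrightarrow> vpath p G \<and> hd p = x \<and> last p = y \<and>
     (\<forall>q. vpath q G \<and> hd q = x \<and> last q = y \<longrightarrow> vwalk_length p \<le> vwalk_length q)"

text \<open>
  A choice of one shortest path for each unordered pair of vertices of \<open>S\<close>: the path chosen
  for \<open>(y, x)\<close> is the one chosen for \<open>(x, y)\<close>, traversed backwards. On the diagonal, \<open>f x x\<close>
  is necessarily the trivial path \<open>[x]\<close>.
\<close>
definition path_choice :: "('a, 'b) pre_digraph \<Rightarrow> 'a set \<Rightarrow> ('a \<Rightarrow> 'a \<Rightarrow> 'a list) \<Rightarrow> bool" where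
  "path_choice G S f \<longleftrightarrow>
     (\<forall>x\<in>S. \<forall>y\<in>S. shortest_path G x y (f x y) \<and> f y x = rev (f x y))"

text \<open>
  The trivial paths \<open>f x x\<close> only contribute the vertices of \<open>S\<close>, which are also endpoints of
  the other chosen paths as soon as \<open>S\<close> has two elements. Hence including them below matters
  only for the one-vertex graph, whose strong geodetic number is thereby 1.
\<close>
definition strong_geodetic_set :: "('a, 'b) pre_digraph \<Rightarrow> 'a set \<Rightarrow> bool" where
  "strong_geodetic_set G S \<longleftrightarrow> S \<subseteq> verts G \<and>
     (\<exists>f. path_choice G S f \<and> (\<Union>x\<in>S. \<Union>y\<in>S. set (f x y)) = verts G)"

definition sg :: "('a, 'b) pre_digraph \<Rightarrow> nat" where
  "sg G = (LEAST k. \<exists>S. strong_geodetic_set G S \<and> card S = k)"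

definition sg_set :: "('a, 'b) pre_digraph \<Rightarrow> 'a set \<Rightarrow> bool" where
  "sg_set G S \<longleftrightarrow> strong_geodetic_set G S \<and> card S = sg G"

definition strong_geodetic_core :: "('a, 'b) pre_digraph \<Rightarrow> 'a set \<Rightarrow> 'a set \<Rightarrow> bool" where
  "strong_geodetic_core G S X \<longleftrightarrow> X \<subseteq> S \<and>
     (\<exists>f. path_choice G S f \<and> (\<Union>(u, v)\<in>X \<times> S. set (f u v)) = verts G)"

definition sgc_of_set :: "('a, 'b) pre_digraph \<Rightarrow> 'a set \<Rightarrow> nat" where
  "sgc_of_set G S = (LEAST k. \<exists>X. strong_geodetic_core G S X \<and> card X = k)"

definition sgc :: "('a, 'b) pre_digraph \<Rightarrow> nat" where
  "sgc G = (LEAST k. \<exists>S. sg_set G S \<and> sgc_of_set G S = k)"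

definition geodesic_interval :: "('a, 'b) pre_digraph \<Rightarrow> 'a \<Rightarrow> 'a \<Rightarrow> 'a set" where
  "geodesic_interval G u v = {w. \<exists>p. shortest_path G u v p \<and> w \<in> set p}"

definition geodetic_set :: "('a, 'b) pre_digraph \<Rightarrow> 'a set \<Rightarrow> bool" where
  "geodetic_set G S \<longleftrightarrow> S \<subseteq> verts G \<and>
     (\<Union>u\<in>S. \<Union>v\<in>S. geodesic_interval G u v) = verts G"

definition geodetic_number :: "('a, 'b) pre_digraph \<Rightarrow> nat" where
  "geodetic_number G = (LEAST k. \<exists>S. geodetic_set G S \<and> card S = k)"

definition generalized_geodetic :: "('a, 'b) pre_digraph \<Rightarrow> bool" where
  "generalized_geodetic G \<longleftrightarrow> geodetic_number G = sg G"

definition convex_subgraph :: "('a, 'b) pre_digraph \<Rightarrow> ('a, 'b) pre_digraph \<Rightarrow> bool" where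
  "convex_subgraph K H \<longleftrightarrow> subgraph K H \<and>
     (\<forall>u\<in>verts K. \<forall>v\<in>verts K. \<forall>p. shortest_path H u v p \<longrightarrow> vpath p K)"

definition admits_convex_2_partition :: "('a, 'b) pre_digraph \<Rightarrow> bool" where
  "admits_convex_2_partition H \<longleftrightarrow>
     (\<exists>A B. A \<noteq> {} \<and> B \<noteq> {} \<and> A \<inter> B = {} \<and> A \<union> B = verts H \<and>
        convex_subgraph (H \<restriction> A) H \<and> convex_subgraph (H \<restriction> B) H)"

end

theory Submission
  imports Defs
begin

text \<open>
  Suppose a strong geodetic set \<open>S\<close> of \<open>G \<box> H\<close> has at most \<open>sg G\<close> elements. Shortest paths of
  the product project to shortest paths of \<open>G\<close>, so \<open>fst ` S\<close> is geodetic in \<open>G\<close>. As \<open>G\<close> is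
  generalized geodetic, \<open>fst\<close> is injective on \<open>S\<close> and \<open>fst ` S\<close>, with the projected paths, is an
  sg-set. Let \<open>{A, B}\<close> be the convex partition of \<open>H\<close>. Paths between two vertices of \<open>S\<close> above \<open>A\<close>
  never leave \<open>V(G) \<times> A\<close>, so every layer over a vertex of \<open>B\<close> is covered by paths with an end in
  the part of \<open>S\<close> above \<open>B\<close>. The projection of that part is therefore a core, and so is the
  projection of the part above \<open>A\<close>. One of them has at most \<open>sg G / 2\<close> elements.
\<close>

section \<open>Shortest paths\<close>

lemma length_vwalk_to_vpath_le: "length (vwalk_to_vpath p) \<le> length p"
  by (induction p rule: vwalk_to_vpath_induct3)
     (auto intro: le_trans[OF _ le_SucI[OF length_dropWhile_le]])

text \<open>Each repeated vertex encloses a closed detour that loop erasure cuts out. This is what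
  forces a walk of minimal length to be a path.\<close>

lemma length_vwalk_to_vpath_less: "\<not> distinct p \<Longrightarrow> length (vwalk_to_vpath p) < length p"
proof (induction p rule: vwalk_to_vpath_induct3)
  case (in_set x xs)
  have "length (vwalk_to_vpath (dropWhile (\<lambda>y. y \<noteq> x) xs)) \<le> length xs"
    using length_vwalk_to_vpath_le length_dropWhile_le le_trans by blast
  then show ?case
    using in_set.hyps by simp
qed auto

lemma vwalk_nonempty: "vwalk p G \<Longrightarrow> p \<noteq> []"
  by (simp add: vwalk_def)

text \<open>Loop erasure never lengthens a walk and strictly shortens one with a repetition, so
  minimising over walks or over paths is the same. The walk form is the convenient one in products,
  where competitors arise by joining and projecting and distinctness would be a burden. Counting
  vertices instead of edges shifts all lengths by one.\<close>

lemma shortest_path_iff: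
  "shortest_path G x y p \<longleftrightarrow> vwalk p G \<and> hd p = x \<and> last p = y \<and>
     (\<forall>q. vwalk q G \<and> hd q = x \<and> last q = y \<longrightarrow> length p \<le> length q)"
    (is "_ \<longleftrightarrow> ?minimal_walk")
proof
  assume sp: "shortest_path G x y p"
  have "length p \<le> length q" if "vwalk q G" "hd q = x" "last q = y" for q
  proof -
    have path: "vpath (vwalk_to_vpath q) G"
      using that(1) by (rule vwalk_to_vpath_vpath)
    have "length p - 1 \<le> length (vwalk_to_vpath q) - 1"
      using sp path that unfolding shortest_path_def
      by (simp add: vwalk_to_vpath_hd vwalk_to_vpath_last)
    \<comment> \<open>Truncated subtraction gives \<open>0 - 1 = 1 - 1\<close>, so the previous
      bound says nothing about an empty list.\<close>
    moreover have "vwalk_to_vpath q \<noteq> []"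
      using path by (auto simp: vpath_def dest: vwalk_nonempty)
    ultimately have "length p \<le> length (vwalk_to_vpath q)"
      by (cases "vwalk_to_vpath q") auto
    then show ?thesis
      using length_vwalk_to_vpath_le le_trans by blast
  qed
  then show ?minimal_walk
    using sp by (auto simp: shortest_path_def vpath_def)
next
  assume p: ?minimal_walk
  have "vwalk (vwalk_to_vpath p) G"
    using p vwalk_to_vpath_vpath by (auto simp: vpath_def)
  then have "length p \<le> length (vwalk_to_vpath p)"
    using p by (simp add: vwalk_to_vpath_hd vwalk_to_vpath_last)
  then have "distinct p"
    using length_vwalk_to_vpath_less by (meson not_le)
  then show "shortest_path G x y p"
    using p by (auto simp: shortest_path_def vpath_def diff_le_mono)
qed

lemma ex_shortest_path:
  assumes "vwalk p G" "hd p = x" "last p = y"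
  shows "\<exists>q. shortest_path G x y q"
proof -
  let ?W = "\<lambda>q. vwalk q G \<and> hd q = x \<and> last q = y"
  have "?W (arg_min length ?W)" "\<forall>q. ?W q \<longrightarrow> length (arg_min length ?W) \<le> length q"
    using arg_min_nat_lemma[of ?W p length] assms by auto
  then show ?thesis
    by (auto simp: shortest_path_iff)
qed

lemma vwalk_rev:
  fixes G :: "'a pair_pre_digraph"
  assumes "sym (parcs G)"
  shows "vwalk (rev p) G \<longleftrightarrow> vwalk p G"
  using assms by (auto simp: vwalk_def set_vwalk_arcs_rev sym_def)

lemma shortest_path_rev:
  fixes G :: "'a pair_pre_digraph"
  assumes "sym (parcs G)" "shortest_path G x y p"
  shows "shortest_path G y x (rev p)"
  unfolding shortest_path_iff
proof (intro conjI allI impI)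
  have p: "vwalk p G" "hd p = x" "last p = y"
    using assms(2) by (auto simp: shortest_path_iff)
  then show "vwalk (rev p) G" "hd (rev p) = y" "last (rev p) = x"
    using vwalk_rev[OF assms(1)] by (auto simp: hd_rev last_rev)
  fix q assume "vwalk q G \<and> hd q = y \<and> last q = x"
  then have "vwalk (rev q) G" "hd (rev q) = x" "last (rev q) = y"
    using vwalk_rev[OF assms(1)] by (auto simp: hd_rev last_rev)
  then show "length (rev p) \<le> length q"
    using assms(2) by (metis length_rev shortest_path_iff)
qed

lemma shortest_path_refl: "shortest_path G x x p \<Longrightarrow> p = [x]"
proof -
  assume sp: "shortest_path G x x p"
  then have p: "vwalk p G" "hd p = x"
    by (auto simp: shortest_path_iff)
  then have "vwalk [x] G"
    by (cases p) (auto simp: vwalk_def)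
  then have "length p \<le> length [x]"
    using sp unfolding shortest_path_iff by (metis last.simps list.sel(1))
  then show ?thesis
    using p by (cases p) (auto simp: vwalk_def)
qed

lemma shortest_path_convex:
  assumes "convex_subgraph (G \<restriction> A) G" "shortest_path G u v p" "u \<in> A" "v \<in> A"
  shows "set p \<subseteq> A"
  using assms by (auto simp: convex_subgraph_def vpath_def vwalk_def)

text \<open>\<open>connected\<close> speaks of reachability in the symmetric closure of the arcs,
  which is the arc set itself when that is symmetric.\<close>

lemma connected_imp_vwalk:
  fixes G :: "'a pair_pre_digraph"
  assumes "connected G" "sym (parcs G)" "x \<in> pverts G" "y \<in> pverts G"
  shows "\<exists>p. vwalk p G \<and> hd p = x \<and> last p = y"
proof -
  have "(parcs G)\<^sup>s = parcs G"
    using assms(2) by (auto simp: symcl_def sym_def)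
  then have "(x, y) \<in> rtrancl_on (pverts G) (parcs G)"
    using assms(1,3,4) by (simp add: connected_conv)
  then show ?thesis
  proof (induction rule: converse_rtrancl_on_induct)
    case base
    then show ?case
      using assms(4) by (intro exI[of _ "[y]"]) (auto simp: vwalk_def)
  next
    case (step x z)
    then obtain p where "vwalk p G" "hd p = z" "last p = y"
      by blast
    then show ?case
      using step.hyps by (intro exI[of _ "x # p"]) (auto intro!: vwalk_consI dest: vwalk_nonempty)
  qed
qed

text \<open>An injection into the naturals orders \<open>S\<close>. A geodesic is picked freely from
  the smaller to the larger end of each pair, and the other direction is its reversal.\<close>

lemma ex_path_choice:
  fixes G :: "'a pair_pre_digraph"
  assumes "finite S" "sym (parcs G)"
    and ex: "\<And>x y. x \<in> S \<Longrightarrow> y \<in> S \<Longrightarrow> \<exists>p. shortest_path G x y p"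
  shows "\<exists>f. path_choice G S f"
proof -
  obtain e :: "'a \<Rightarrow> nat" where e: "inj_on e S"
    using finite_imp_inj_to_nat_seg[OF assms(1)] by blast
  define c where "c x y = (SOME p. shortest_path G x y p)" for x y
  define f where "f x y = (if e x \<le> e y then c x y else rev (c y x))" for x y
  have c: "shortest_path G x y (c x y)" if "x \<in> S" "y \<in> S" for x y
    unfolding c_def using ex[OF that] by (rule someI_ex)
  have "shortest_path G x y (f x y)" if "x \<in> S" "y \<in> S" for x y
    using c that shortest_path_rev[OF assms(2)] by (simp add: f_def)
  moreover have "f y x = rev (f x y)" if "x \<in> S" "y \<in> S" for x y
  proof (cases "x = y")
    case True
    then show ?thesis
      \<comment> \<open>On the diagonal the chosen path is \<open>[x]\<close>, which is its own
        reversal.\<close>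
      using shortest_path_refl[OF c[OF that(1) that(1)]] by (simp add: f_def)
  next
    case False
    then have "e x \<noteq> e y"
      using e that by (auto dest: inj_onD)
    then show ?thesis
      by (auto simp: f_def)
  qed
  ultimately show ?thesis
    unfolding path_choice_def by blast
qed

lemma path_choice_shortest_path:
  "path_choice G S f \<Longrightarrow> x \<in> S \<Longrightarrow> y \<in> S \<Longrightarrow> shortest_path G x y (f x y)"
  unfolding path_choice_def by blast

lemma path_choice_rev:
  "path_choice G S f \<Longrightarrow> x \<in> S \<Longrightarrow> y \<in> S \<Longrightarrow> f y x = rev (f x y)"
  unfolding path_choice_def by blast

lemma path_choice_subset:
  "path_choice G S f \<Longrightarrow> x \<in> S \<Longrightarrow> y \<in> S \<Longrightarrow> set (f x y) \<subseteq> verts G"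
  by (drule (2) path_choice_shortest_path) (simp add: shortest_path_iff vwalk_def)

lemma path_choice_endpoint:
  assumes "path_choice G S f" "x \<in> S" "y \<in> S"
  shows "x \<in> set (f x y)"
proof -
  have "vwalk (f x y) G" "hd (f x y) = x"
    using path_choice_shortest_path[OF assms] by (auto simp: shortest_path_iff)
  then show ?thesis
    by (cases "f x y") (auto simp: vwalk_def)
qed

lemma path_choice_verts: "path_choice G S f \<Longrightarrow> S \<subseteq> verts G"
  using path_choice_endpoint[of G S f] path_choice_subset[of G S f] by (meson subsetD subsetI)

lemma strong_geodetic_coreI:
  assumes X: "X \<subseteq> S" and f: "path_choice G S f"
    and cover: "\<And>w. w \<in> verts G \<Longrightarrow> \<exists>u\<in>X. \<exists>v\<in>S. w \<in> set (f u v)"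
  shows "strong_geodetic_core G S X"
proof -
  have "(\<Union>(u, v)\<in>X \<times> S. set (f u v)) = verts G"
  proof
    show "(\<Union>(u, v)\<in>X \<times> S. set (f u v)) \<subseteq> verts G"
      using path_choice_subset[OF f] X by blast
    show "verts G \<subseteq> (\<Union>(u, v)\<in>X \<times> S. set (f u v))"
      using cover by blast
  qed
  then show ?thesis
    unfolding strong_geodetic_core_def using X f by blast
qed

text \<open>The full vertex set is strong geodetic, since the ends of the chosen paths already cover
  everything. Hence the \<open>LEAST\<close> in \<open>sg\<close> is attained.\<close>

lemma ex_sg_set:
  fixes G :: "'a pair_pre_digraph"
  assumes "finite (pverts G)" "sym (parcs G)"
    and ex: "\<And>x y. x \<in> pverts G \<Longrightarrow> y \<in> pverts G \<Longrightarrow> \<exists>p. vwalk p G \<and> hd p = x \<and> last p = y"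
  shows "\<exists>S. sg_set G S"
proof -
  obtain f where f: "path_choice G (pverts G) f"
    using ex_path_choice[OF assms(1,2)] ex_shortest_path ex by metis
  have "(\<Union>x\<in>pverts G. \<Union>y\<in>pverts G. set (f x y)) = pverts G"
    using path_choice_subset[OF f] path_choice_endpoint[OF f] by fastforce
  then have "strong_geodetic_set G (pverts G)"
    using f by (auto simp: strong_geodetic_set_def)
  then have "\<exists>k S. strong_geodetic_set G S \<and> card S = k"
    by blast
  from LeastI_ex[OF this] show ?thesis
    by (simp add: sg_set_def sg_def)
qed

section \<open>Walks in Cartesian products\<close>

lemma pverts_box [simp]: "pverts (G \<box> H) = pverts G \<times> pverts H"
  by (simp add: cartesian_product_def)

lemma parcs_box:
  "((g, h), (g', h')) \<in> parcs (G \<box> H) \<longleftrightarrow>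
     g = g' \<and> g \<in> pverts G \<and> (h, h') \<in> parcs H \<or>
     h = h' \<and> h \<in> pverts H \<and> (g, g') \<in> parcs G"
  by (auto simp: cartesian_product_def)

lemma sym_parcs_box: "sym (parcs G) \<Longrightarrow> sym (parcs H) \<Longrightarrow> sym (parcs (G \<box> H))"
  by (auto simp: sym_def parcs_box)

text \<open>A step in one factor leaves the other coordinate still, and \<open>remdups_adj\<close>
  removes the resulting stutter. Each arc thus lengthens at most one projection; the
  \<open>Suc\<close> arises because the starting vertex is counted in both. Loops, which may occur
  here, lengthen neither.\<close>

lemma vwalk_box_projections:
  fixes G :: "'a pair_pre_digraph" and H :: "'b pair_pre_digraph"
  assumes "pair_wf_digraph G" "pair_wf_digraph H" "vwalk p (G \<box> H)"
  shows "vwalk (remdups_adj (map fst p)) G \<and> vwalk (remdups_adj (map snd p)) H \<and>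
    length (remdups_adj (map fst p)) + length (remdups_adj (map snd p)) \<le> Suc (length p)"
  using assms(3)
proof (induction p rule: vwalk_induct)
  case (Base u)
  then show ?case
    by (auto simp: vwalk_def)
next
  case (Cons u v es)
  obtain g h g' h' where uv: "u = (g, h)" "v = (g', h')"
    by fastforce
  have arc: "g = g' \<and> (h, h') \<in> parcs H \<or> h = h' \<and> (g, g') \<in> parcs G"
    using Cons.hyps by (auto simp: uv parcs_box)
  show ?case
    using arc
  proof
    assume "g = g' \<and> (h, h') \<in> parcs H"
    then show ?thesis
      using Cons.IH pair_wf_digraph.in_arcsD1[OF assms(2)]
      by (auto simp: uv intro!: vwalk_consI)
  next
    assume "h = h' \<and> (g, g') \<in> parcs G"
    then show ?thesis
      using Cons.IH pair_wf_digraph.in_arcsD1[OF assms(1)]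
      by (auto simp: uv intro!: vwalk_consI)
  qed
qed

lemma vwalk_arcs_map: "vwalk_arcs (map f p) = map (map_prod f f) (vwalk_arcs p)"
  by (induction p rule: vwalk_arcs.induct) auto

lemma vwalk_box_left:
  fixes G :: "'a pair_pre_digraph" and H :: "'b pair_pre_digraph"
  shows "vwalk p G \<Longrightarrow> h \<in> pverts H \<Longrightarrow> vwalk (map (\<lambda>g. (g, h)) p) (G \<box> H)"
  by (auto simp: vwalk_def vwalk_arcs_map parcs_box)

lemma vwalk_box_right:
  fixes G :: "'a pair_pre_digraph" and H :: "'b pair_pre_digraph"
  shows "vwalk p H \<Longrightarrow> g \<in> pverts G \<Longrightarrow> vwalk (map (Pair g) p) (G \<box> H)"
  by (auto simp: vwalk_def vwalk_arcs_map parcs_box)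

text \<open>Follow \<open>p\<close> in the layer over \<open>hd q\<close>, then \<open>q\<close> in
  the layer over \<open>last p\<close>. The corner is shared by both pieces, hence the
  \<open>Suc\<close>.\<close>

lemma vwalk_box_combine:
  fixes G :: "'a pair_pre_digraph" and H :: "'b pair_pre_digraph"
  assumes "vwalk p G" "vwalk q H"
  obtains r where "vwalk r (G \<box> H)" "hd r = (hd p, hd q)" "last r = (last p, last q)"
    "Suc (length r) = length p + length q"
proof
  let ?p = "map (\<lambda>g. (g, hd q)) p" and ?q = "map (Pair (last p)) q"
  have ne: "p \<noteq> []" "q \<noteq> []"
    using assms by (auto simp: vwalk_def)
  then have "last p \<in> pverts G" "hd q \<in> pverts H"
    using assms by (auto simp: vwalk_def)
  then have "vwalk ?p (G \<box> H)" "vwalk ?q (G \<box> H)"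
    using assms by (auto intro: vwalk_box_left vwalk_box_right)
  moreover have join: "joinable ?p ?q"
    using ne by (simp add: last_map hd_map)
  ultimately show "vwalk (?p \<oplus> ?q) (G \<box> H)"
    by (rule vwalk_joinI_vwalk)
  show "hd (?p \<oplus> ?q) = (hd p, hd q)" "last (?p \<oplus> ?q) = (last p, last q)"
    using ne by (simp_all add: vwalk_join_hd[OF join] vwalk_join_last[OF join] hd_map last_map)
  show "Suc (length (?p \<oplus> ?q)) = length p + length q"
    using ne by (cases q) (auto simp: vwalk_join_def)
qed

text \<open>Distances in the product are sums of distances in the factors: any two competing walks
  combine to a product walk, which is no shorter than \<open>p\<close>, so the projections of
  \<open>p\<close> have minimal total length.\<close>

lemma shortest_path_box_projections:
  fixes G :: "'a pair_pre_digraph" and H :: "'b pair_pre_digraph"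
  assumes "pair_wf_digraph G" "pair_wf_digraph H" "shortest_path (G \<box> H) x y p"
  shows "shortest_path G (fst x) (fst y) (remdups_adj (map fst p))" (is "shortest_path _ _ _ ?p")
    and "shortest_path H (snd x) (snd y) (remdups_adj (map snd p))" (is "shortest_path _ _ _ ?q")
proof -
  have p: "vwalk p (G \<box> H)" "hd p = x" "last p = y" "p \<noteq> []"
    using assms(3) by (auto simp: shortest_path_iff vwalk_def)
  have walks: "vwalk ?p G" "vwalk ?q H" and len: "length ?p + length ?q \<le> Suc (length p)"
    using vwalk_box_projections[OF assms(1,2) p(1)] by auto
  have ends: "hd ?p = fst x" "last ?p = fst y" "hd ?q = snd x" "last ?q = snd y"
    using p by (auto simp: hd_map last_map)
  have le: "length ?p + length ?q \<le> length p' + length q'"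
    if p': "vwalk p' G" "hd p' = fst x" "last p' = fst y"
      and q': "vwalk q' H" "hd q' = snd x" "last q' = snd y" for p' q'
  proof -
    obtain r where r: "vwalk r (G \<box> H)" "hd r = x" "last r = y"
      "Suc (length r) = length p' + length q'"
      using vwalk_box_combine[OF p'(1) q'(1)] p' q' by auto
    then have "length p \<le> length r"
      using assms(3) by (auto simp: shortest_path_iff)
    then show ?thesis
      using len r(4) by linarith
  qed
  \<comment> \<open>Taking \<open>?q\<close> itself as the competitor in \<open>H\<close> cancels it
    from \<open>le\<close> and leaves minimality of \<open>?p\<close>; the other factor is
    symmetric.\<close>
  show "shortest_path G (fst x) (fst y) ?p"
    using walks ends le[OF _ _ _ walks(2) ends(3,4)] by (auto simp: shortest_path_iff)
  show "shortest_path H (snd x) (snd y) ?q"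
    using walks ends le[OF walks(1) ends(1,2)] by (auto simp: shortest_path_iff)
qed

section \<open>Projecting strong geodetic sets\<close>

lemma pair_graph_sym: "pair_graph G \<Longrightarrow> sym (parcs G)"
  using pair_sym_digraph.pair_sym_arcs[of G] pair_graph.axioms(2) pair_pseudo_graph.axioms(2)
  by (fastforce simp: symmetric_def)

lemma ex_sg_set_box:
  fixes G :: "'a pair_pre_digraph" and H :: "'b pair_pre_digraph"
  assumes "pair_graph G" "connected G" "pair_graph H" "connected H"
  shows "\<exists>S. sg_set (G \<box> H) S"
proof (rule ex_sg_set)
  interpret G: pair_graph G by fact
  interpret H: pair_graph H by fact
  show "finite (pverts (G \<box> H))"
    using G.pair_finite_verts H.pair_finite_verts by simp
  show "sym (parcs (G \<box> H))"
    using assms by (intro sym_parcs_box pair_graph_sym)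
  fix x y assume xy: "x \<in> pverts (G \<box> H)" "y \<in> pverts (G \<box> H)"
  obtain p where p: "vwalk p G" "hd p = fst x" "last p = fst y"
    using connected_imp_vwalk[OF assms(2) pair_graph_sym[OF assms(1)], of "fst x" "fst y"] xy
    by auto
  obtain q where q: "vwalk q H" "hd q = snd x" "last q = snd y"
    using connected_imp_vwalk[OF assms(4) pair_graph_sym[OF assms(3)], of "snd x" "snd y"] xy
    by auto
  show "\<exists>r. vwalk r (G \<box> H) \<and> hd r = x \<and> last r = y"
    using vwalk_box_combine[OF p(1) q(1)] p q by (metis prod.collapse)
qed

definition proj_choice :: "('a \<times> 'b) set \<Rightarrow> ('a \<times> 'b \<Rightarrow> 'a \<times> 'b \<Rightarrow> ('a \<times> 'b) list) \<Rightarrow>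
    'a \<Rightarrow> 'a \<Rightarrow> 'a list" where
  "proj_choice S f a b = remdups_adj (map fst (f (inv_into S fst a) (inv_into S fst b)))"

lemma proj_choice_fst:
  assumes "inj_on fst S" "x \<in> S" "y \<in> S"
  shows "proj_choice S f (fst x) (fst y) = remdups_adj (map fst (f x y))"
  using assms by (simp add: proj_choice_def)

lemma path_choice_proj:
  fixes G :: "'a pair_pre_digraph" and H :: "'b pair_pre_digraph"
  assumes "pair_wf_digraph G" "pair_wf_digraph H" "path_choice (G \<box> H) S f" "inj_on fst S"
  shows "path_choice G (fst ` S) (proj_choice S f)"
  unfolding path_choice_def
proof (intro ballI)
  fix a b assume "a \<in> fst ` S" "b \<in> fst ` S"
  then obtain x y where xy: "x \<in> S" "y \<in> S" and ab: "a = fst x" "b = fst y"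
    by blast
  note rev = path_choice_rev[OF assms(3) xy]
  show "shortest_path G a b (proj_choice S f a b) \<and>
      proj_choice S f b a = rev (proj_choice S f a b)"
    using shortest_path_box_projections(1)[OF assms(1,2) path_choice_shortest_path[OF assms(3) xy]] xy
    by (simp add: ab proj_choice_fst[OF assms(4)] rev rev_map[symmetric])
qed

text \<open>Covering a single layer, over some \<open>h\<close>, is enough. Only a geodetic set
  results: without injectivity of \<open>fst\<close>, different pairs of \<open>S\<close> may
  project to one pair with different geodesics.\<close>

lemma geodetic_set_fst:
  fixes G :: "'a pair_pre_digraph" and H :: "'b pair_pre_digraph"
  assumes "pair_wf_digraph G" "pair_wf_digraph H" "pverts H \<noteq> {}"
    and "strong_geodetic_set (G \<box> H) S"
  shows "geodetic_set G (fst ` S)"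
proof -
  obtain f where S: "S \<subseteq> pverts G \<times> pverts H" and f: "path_choice (G \<box> H) S f"
    and cover: "(\<Union>x\<in>S. \<Union>y\<in>S. set (f x y)) = pverts G \<times> pverts H"
    using assms(4) by (auto simp: strong_geodetic_set_def)
  obtain h where h: "h \<in> pverts H"
    using assms(3) by blast
  have "\<exists>u\<in>fst ` S. \<exists>v\<in>fst ` S. g \<in> geodesic_interval G u v" if "g \<in> pverts G" for g
  proof -
    have "(g, h) \<in> (\<Union>x\<in>S. \<Union>y\<in>S. set (f x y))"
      using that h cover by simp
    then obtain x y where xy: "x \<in> S" "y \<in> S" "(g, h) \<in> set (f x y)"
      by blast
    have "shortest_path G (fst x) (fst y) (remdups_adj (map fst (f x y)))"
      using shortest_path_box_projections(1)[OF assms(1,2) path_choice_shortest_path[OF f]] xy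
      by blast
    moreover have "g \<in> set (remdups_adj (map fst (f x y)))"
      using xy(3) by force
    ultimately show ?thesis
      using xy(1,2) unfolding geodesic_interval_def by blast
  qed
  moreover have "geodesic_interval G u v \<subseteq> pverts G" for u v
    by (auto simp: geodesic_interval_def shortest_path_iff vwalk_def)
  ultimately show ?thesis
    using S by (fastforce simp: geodetic_set_def)
qed

text \<open>Look at the layer over one \<open>b\<close> in \<open>B\<close>. A chosen path through
  it with both ends above \<open>A\<close> would project to a geodesic of \<open>H\<close> that
  leaves the convex set \<open>A\<close>. So convexity of \<open>A\<close> yields a core above
  \<open>B\<close>.\<close>

lemma strong_geodetic_core_fst:
  fixes G :: "'a pair_pre_digraph" and H :: "'b pair_pre_digraph"
  assumes "pair_wf_digraph G" "pair_wf_digraph H"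
    and f: "path_choice (G \<box> H) S f"
    and cover: "(\<Union>x\<in>S. \<Union>y\<in>S. set (f x y)) = pverts G \<times> pverts H"
    and inj: "inj_on fst S"
    and convex: "convex_subgraph (H \<restriction> A) H" and AB: "A \<union> B = pverts H" "A \<inter> B = {}" "B \<noteq> {}"
  shows "strong_geodetic_core G (fst ` S) (fst ` {x \<in> S. snd x \<in> B})"
proof -
  let ?X = "fst ` {x \<in> S. snd x \<in> B}"
  have choice: "path_choice G (fst ` S) (proj_choice S f)"
    using assms(1,2) f inj by (rule path_choice_proj)
  obtain b where b: "b \<in> B"
    using AB(3) by blast
  have "\<exists>u\<in>?X. \<exists>v\<in>fst ` S. g \<in> set (proj_choice S f u v)" if "g \<in> pverts G" for g
  proof -
    have "(g, b) \<in> (\<Union>x\<in>S. \<Union>y\<in>S. set (f x y))"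
      using that b cover AB(1) by auto
    then obtain x y where xy: "x \<in> S" "y \<in> S" "(g, b) \<in> set (f x y)"
      by blast
    note sp = path_choice_shortest_path[OF f xy(1,2)] and rev = path_choice_rev[OF f xy(1,2)]
    have "snd x \<in> B \<or> snd y \<in> B"
    proof (rule ccontr)
      assume "\<not> (snd x \<in> B \<or> snd y \<in> B)"
      moreover have "snd x \<in> pverts H" "snd y \<in> pverts H"
        using path_choice_verts[OF f] xy(1,2) by (auto simp: mem_Times_iff)
      ultimately have "snd x \<in> A" "snd y \<in> A"
        using AB(1) by blast+
      then have "set (remdups_adj (map snd (f x y))) \<subseteq> A"
        by (rule shortest_path_convex[OF convex
              shortest_path_box_projections(2)[OF assms(1,2) sp]])
      then have "b \<in> A"
        using xy(3) by force
      then show False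
        using b AB(2) by blast
    qed
    \<comment> \<open>It is unknown which end lies above \<open>B\<close>, while a core needs that
      end first; reversal symmetry of the choice supplies both orders.\<close>
    moreover have "g \<in> set (proj_choice S f (fst x) (fst y))"
      "g \<in> set (proj_choice S f (fst y) (fst x))"
      unfolding proj_choice_fst[OF inj xy(1,2)] proj_choice_fst[OF inj xy(2,1)] rev
      using xy(3) by force+
    ultimately show ?thesis
      using xy(1,2) by blast
  qed
  then show ?thesis
    by (intro strong_geodetic_coreI[OF _ choice]) auto
qed

lemma strong_geodetic_core_imp_strong_geodetic_set:
  assumes "strong_geodetic_core G S X" "S \<subseteq> verts G"
  shows "strong_geodetic_set G S"
proof -
  obtain f where X: "X \<subseteq> S" and f: "path_choice G S f"
    and cover: "(\<Union>(u, v)\<in>X \<times> S. set (f u v)) = verts G"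
    using assms(1) unfolding strong_geodetic_core_def by blast
  have "(\<Union>u\<in>S. \<Union>v\<in>S. set (f u v)) = verts G"
  proof
    show "(\<Union>u\<in>S. \<Union>v\<in>S. set (f u v)) \<subseteq> verts G"
      using path_choice_subset[OF f] by blast
    show "verts G \<subseteq> (\<Union>u\<in>S. \<Union>v\<in>S. set (f u v))"
      unfolding cover[symmetric] using X by (auto intro!: bexI)
  qed
  then show ?thesis
    unfolding strong_geodetic_set_def using f assms(2) by blast
qed

lemma sgc_le_card_core:
  assumes "sg_set G S" "strong_geodetic_core G S X"
  shows "sgc G \<le> card X"
proof -
  have "sgc G \<le> sgc_of_set G S"
    unfolding sgc_def using assms(1) by (intro Least_le) blast
  also have "\<dots> \<le> card X"
    unfolding sgc_of_set_def using assms(2) by (intro Least_le) blast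
  finally show ?thesis .
qed

theorem theorem6p5:
  fixes G :: "'a pair_pre_digraph" and H :: "'b pair_pre_digraph"
  assumes "pair_graph G" and "connected G"
    and "pair_graph H" and "connected H"
    and "generalized_geodetic G"
    and "real (sgc G) > real (sg G) / 2"
    and "admits_convex_2_partition H"
  shows "sg (G \<box> H) > sg G"
proof (rule ccontr)
  assume "\<not> sg (G \<box> H) > sg G"
  moreover obtain S where "sg_set (G \<box> H) S"
    using ex_sg_set_box[OF assms(1-4)] by blast
  ultimately have S: "strong_geodetic_set (G \<box> H) S" and card_S: "card S \<le> sg G"
    by (auto simp: sg_set_def)
  interpret G: pair_graph G by fact
  interpret H: pair_graph H by fact
  note wf = G.pair_wf_digraph_axioms H.pair_wf_digraph_axioms
  obtain f where SV: "S \<subseteq> pverts G \<times> pverts H" and f: "path_choice (G \<box> H) S f"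
    and cover: "(\<Union>x\<in>S. \<Union>y\<in>S. set (f x y)) = pverts G \<times> pverts H"
    using S by (auto simp: strong_geodetic_set_def)
  obtain A B where AB: "A \<noteq> {}" "B \<noteq> {}" "A \<inter> B = {}" "A \<union> B = pverts H"
    and convex: "convex_subgraph (H \<restriction> A) H" "convex_subgraph (H \<restriction> B) H"
    using assms(7) by (auto simp: admits_convex_2_partition_def)
  have fin: "finite S"
    using SV G.pair_finite_verts H.pair_finite_verts finite_subset by blast
  have "geodetic_set G (fst ` S)"
    using AB by (intro geodetic_set_fst[OF wf _ S]) auto
  then have "geodetic_number G \<le> card (fst ` S)"
    unfolding geodetic_number_def by (intro Least_le) blast
  then have card: "card (fst ` S) = card S" "card S = sg G"
    using card_S card_image_le[OF fin, of fst] assms(5) by (auto simp: generalized_geodetic_def)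
  then have inj: "inj_on fst S"
    using fin by (intro eq_card_imp_inj_on)
  let ?S = "\<lambda>C. {x \<in> S. snd x \<in> C}"
  \<comment> \<open>The roles cross: the core above \<open>A\<close> comes from convexity of
    \<open>B\<close>, and conversely.\<close>
  have coreA: "strong_geodetic_core G (fst ` S) (fst ` ?S A)"
    using AB by (intro strong_geodetic_core_fst[OF wf f cover inj convex(2)]) auto
  have coreB: "strong_geodetic_core G (fst ` S) (fst ` ?S B)"
    using AB by (intro strong_geodetic_core_fst[OF wf f cover inj convex(1)]) auto
  have "sg_set G (fst ` S)"
    using strong_geodetic_core_imp_strong_geodetic_set[OF coreA] SV card
    by (fastforce simp: sg_set_def)
  then have "sgc G \<le> card (fst ` ?S A)" "sgc G \<le> card (fst ` ?S B)"
    using coreA coreB by (auto intro: sgc_le_card_core)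
  moreover have "card (fst ` ?S A) \<le> card (?S A)" "card (fst ` ?S B) \<le> card (?S B)"
    using fin by (simp_all add: card_image_le)
  \<comment> \<open>Every vertex of \<open>S\<close> lies above exactly one of \<open>A\<close> and
    \<open>B\<close>, so two cores share \<open>sg G\<close> vertices and \<open>sgc G\<close> is at
    most half of that.\<close>
  moreover have "card (?S A) + card (?S B) = card S"
    using AB SV fin by (subst card_Un_disjoint[symmetric]) (auto intro!: arg_cong[where f = card])
  ultimately have "2 * sgc G \<le> sg G"
    using card(2) by linarith
  then show False
    using assms(6) by linarith
qed

end
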